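(* Let $A\in\mathbb{R}^{m\times n}$ have rows $a_1^\top,\dots,a_m^\top$, all nonzero, and let $b\in\mathbb{R}^m$ be such that the linear system $Ax=b$ is consistent. Let $x^{(0)}\in\mathbb{R}^n$ and let $x^\star=A^\dagger b+(I-A^\dagger A)x^{(0)}$ denote the orthogonal projection of $x^{(0)}$ onto the solution set of $Ax=b$. Let $\{x^{(k)}\}_{k\ge 0}$ be any iteration sequence generated by the improved greedy randomized Kaczmarz (iGRK) method started at $x^{(0)}$. Then, deterministically (that is, for every realization of the random indices $i_k\in\mathcal{J}_k$), for every $k\ge 0$, $$\|x^{(k+1)}-x^\star\|_2^2\le\left(1-\frac{\sigma_{\min}^2(A)}{\Gamma_k}\right)\|x^{(k)}-x^\star\|_2^2,$$ where $\Gamma_k=\sum_{i\in\mathcal{N}_k}\|a_i\|_2^2$ and $\mathcal{N}_k=\{i\in[m]:\langle a_i,x^{(k)}\rangle-b_i\neq 0\}$.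
   Context: Notation: $[m]=\{1,\dots,m\}$; $a_i\in\mathbb{R}^n$ is the transpose of the $i$-th row of $A$; $b_i$ is the $i$-th entry of $b$; $A^\dagger$ is the Moore–Penrose pseudoinverse; $\sigma_{\min}(A)$ is the smallest nonzero singular value of $A$. The iGRK method: starting from $x^{(0)}$, for $k=0,1,2,\dots$: (1) set $\mathcal{N}_k=\{i\in[m]:|\langle a_i,x^{(k)}\rangle-b_i|\ne 0\}$ and $\Gamma_k=\sum_{i\in\mathcal{N}_k}\|a_i\|_2^2$; (2) set $$\mathcal{J}_k=\left\{i\in[m]:\frac{|\langle a_i,x^{(k)}\rangle-b_i|^2}{\|a_i\|_2^2}\ge\frac12\left(\max_{j\in[m]}\frac{|\langle a_j,x^{(k)}\rangle-b_j|^2}{\|a_j\|_2^2}+\frac{\|Ax^{(k)}-b\|_2^2}{\Gamma_k}\right)\right\};$$ (3) select $i_k\in\mathcal{J}_k$ according to an arbitrary probability distribution $(p^{(k)}_i)_{i\in[m]}$ with $p_i^{(k)}=0$ for $i\notin\mathcal{J}_k$, $p_i^{(k)}\ge 0$ for $i\in\mathcal{J}_k$ and $\sum_{i\in\mathcal{J}_k}p_i^{(k)}=1$; (4) set $x^{(k+1)}=x^{(k)}-\frac{\langle a_{i_k},x^{(k)}\rangle-b_{i_k}}{\|a_{i_k}\|_2^2}a_{i_k}$. Degenerate case: if $Ax^{(k)}=b$, then $\mathcal{N}_k=\emptyset$ and $\Gamma_k=0$; in that case the quotient $\|Ax^{(k)}-b\|_2^2/\Gamma_k=0/0$ is read as $0$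 (so $x^{(k+1)}=x^{(k)}$), and the right-hand side of the claimed inequality is read as $0$. *)

theory Defs
  imports "HOL-Analysis.Analysis" "HOL-Probability.Probability_Mass_Function"
begin

text \<open>
  An \<open>m \<times> n\<close> real matrix is a term of type \<^typ>\<open>real^'n^'m\<close>; its \<open>i\<close>-th row, read as a
  (column) vector, is \<^term>\<open>row i A\<close>.
\<close>

text \<open>The four Penrose conditions; they determine the pseudoinverse uniquely.\<close>

definition is_pseudoinverse :: "real^'n^'m \<Rightarrow> real^'m^'n \<Rightarrow> bool" where
  "is_pseudoinverse A X \<longleftrightarrow>
     A ** X ** A = A \<and> X ** A ** X = X \<and>
     transpose (A ** X) = A ** X \<and> transpose (X ** A) = X ** A"

definition pseudoinverse :: "real^'n^'m \<Rightarrow> real^'m^'n" where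
  "pseudoinverse A = (THE X. is_pseudoinverse A X)"

text \<open>
  Singular values as square roots of the eigenvalues of \<open>A\<^sup>T A\<close>. Conventions differ on whether
  \<open>0\<close> belongs to this set when \<open>m < n\<close>; only the nonzero elements matter below.
\<close>

definition singular_values :: "real^'n^'m \<Rightarrow> real set" where
  "singular_values A =
     {sqrt l | l. \<exists>v. v \<noteq> 0 \<and> (transpose A ** A) *v v = l *\<^sub>R v}"

text \<open>Meaningful for \<open>A \<noteq> 0\<close> only: the zero matrix has no nonzero singular value.\<close>

definition sigma_min :: "real^'n^'m \<Rightarrow> real" where
  "sigma_min A = (LEAST s. s \<in> singular_values A \<and> s \<noteq> 0)"

definition iGRK_N :: "real^'n^'m \<Rightarrow> real^'m \<Rightarrow> real^'n \<Rightarrow> 'm set" where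
  "iGRK_N A b x = {i. row i A \<bullet> x - b $ i \<noteq> 0}"

definition iGRK_Gamma :: "real^'n^'m \<Rightarrow> real^'m \<Rightarrow> real^'n \<Rightarrow> real" where
  "iGRK_Gamma A b x = (\<Sum>i\<in>iGRK_N A b x. (norm (row i A))\<^sup>2)"

text \<open>
  If \<open>A x = b\<close>, the last quotient is \<open>0 / 0\<close>, which is \<open>0\<close> in HOL; this is the intended reading.
\<close>

definition iGRK_J :: "real^'n^'m \<Rightarrow> real^'m \<Rightarrow> real^'n \<Rightarrow> 'm set" where
  "iGRK_J A b x =
     {i. \<bar>row i A \<bullet> x - b $ i\<bar>\<^sup>2 / (norm (row i A))\<^sup>2 \<ge>
         1 / 2 * (Max (range (\<lambda>j. \<bar>row j A \<bullet> x - b $ j\<bar>\<^sup>2 / (norm (row j A))\<^sup>2))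
                  + (norm (A *v x - b))\<^sup>2 / iGRK_Gamma A b x)}"

definition kaczmarz_step :: "real^'n^'m \<Rightarrow> real^'m \<Rightarrow> 'm \<Rightarrow> real^'n \<Rightarrow> real^'n" where
  "kaczmarz_step A b i x = x - ((row i A \<bullet> x - b $ i) / (norm (row i A))\<^sup>2) *\<^sub>R row i A"

text \<open>
  \<open>x\<close> is one realization of the method started at \<open>x0\<close>: \<open>p k\<close> is the distribution used in step
  \<open>k\<close> (which may depend on the history, i.e. vary with the realization) and \<open>i k\<close> the index drawn
  from it. As \<open>p\<close> is arbitrary, point masses included, \<open>i k\<close> ranges over the whole of
  \<^term>\<open>iGRK_J A b (x k)\<close>.
\<close>

definition iGRK_sequence ::
    "real^'n^'m \<Rightarrow> real^'m \<Rightarrow> real^'n \<Rightarrow> (nat \<Rightarrow> real^'n) \<Rightarrow> bool" where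
  "iGRK_sequence A b x0 x \<longleftrightarrow>
     x 0 = x0 \<and>
     (\<exists>(p :: nat \<Rightarrow> 'm pmf) (i :: nat \<Rightarrow> 'm). \<forall>k.
        set_pmf (p k) \<subseteq> iGRK_J A b (x k) \<and>
        i k \<in> set_pmf (p k) \<and>
        x (Suc k) = kaczmarz_step A b (i k) (x k))"

end

theory Submission
  imports Defs
begin

text \<open>
  The error \<open>x k - xstar\<close> never leaves the row space of \<open>A\<close>. A Kaczmarz step with index \<open>i\<close> is an
  orthogonal projection, so it decreases the squared error by \<open>r\<^sub>i\<^sup>2 / \<parallel>a\<^sub>i\<parallel>\<^sup>2\<close>, where \<open>r\<close> is the
  residual. The weighted mean \<open>\<parallel>r\<parallel>\<^sup>2 / \<Gamma>\<^sub>k\<close> of these ratios is at most their maximum, hence at most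
  the greedy threshold, which averages the two; and on the row space \<open>\<parallel>A e\<parallel>\<^sup>2 \<ge> \<sigma>\<^sup>2 \<parallel>e\<parallel>\<^sup>2\<close> for the
  smallest nonzero singular value \<open>\<sigma>\<close>.
\<close>

section \<open>The pseudoinverse\<close>

lemma inner_transpose_mult:
  fixes A :: "real^'n^'m"
  shows "(transpose A *v x) \<bullet> y = x \<bullet> (A *v y)"
  by (simp add: dot_lmul_matrix transpose_matrix_vector)

lemma transpose_mult_self_eq_0_iff:
  fixes A :: "real^'n^'m"
  shows "transpose A *v (A *v x) = 0 \<longleftrightarrow> A *v x = 0"
  by (metis inner_transpose_mult inner_eq_zero_iff inner_zero_left matrix_vector_mult_0_right)

text \<open>A linear map has a linear right inverse on its range, and \<open>G\<close> is the matrix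
  of one.\<close>

lemma matrix_inner_inverse_exists:
  fixes A :: "real^'n^'m"
  obtains G where "A ** G ** A = A"
proof -
  obtain g where "linear g" and g: "\<And>v. A *v g (A *v v) = A *v v"
    using linear_exists_right_inverse_on[OF matrix_vector_mul_linear[of A] subspace_UNIV] by auto
  have "A ** matrix g ** A = A"
    by (simp add: matrix_eq matrix_vector_mul_assoc[symmetric] matrix_works \<open>linear g\<close> g
        linear_matrix_vector_mul_eq)
  then show thesis by (rule that)
qed

text \<open>Solving the normal equations: with \<open>G\<close> an inner inverse of
  \<open>transpose A ** A\<close>, the choice \<open>Y = G ** transpose A\<close> makes
  \<open>A ** Y\<close> the orthogonal projection onto the column space.\<close>

lemma least_squares_inverse_exists:
  fixes A :: "real^'n^'m"
  obtains Y where "A ** Y ** A = A" "transpose (A ** Y) = A ** Y"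
proof -
  obtain G where G: "(transpose A ** A) ** G ** (transpose A ** A) = transpose A ** A"
    using matrix_inner_inverse_exists .
  define P where "P = A ** (G ** transpose A)"
  have PA: "P ** A = A"
  proof -
    have "A *v (G *v (transpose A *v (A *v v)) - v) = 0" for v
    proof -
      have "(transpose A ** A ** G ** (transpose A ** A)) *v v = (transpose A ** A) *v v"
        by (simp add: G)
      then have "transpose A *v (A *v (G *v (transpose A *v (A *v v)) - v)) = 0"
        by (simp add: matrix_vector_mul_assoc[symmetric] matrix_vector_mult_diff_distrib)
      \<comment> \<open>The left factor \<open>transpose A\<close> cancels, since it is injective on
        the range of \<open>A\<close>.\<close>
      then show ?thesis
        by (simp only: transpose_mult_self_eq_0_iff)
    qed
    then show ?thesis
      by (simp add: P_def matrix_eq matrix_vector_mul_assoc[symmetric] matrix_vector_mult_diff_distrib)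
  qed
  \<comment> \<open>Multiplied on the left by \<open>A ** G\<close>, this becomes
    \<open>P ** transpose P = P\<close>, whose left side is symmetric.\<close>
  have "transpose A ** transpose P = transpose A"
    using PA by (metis matrix_transpose_mul)
  then have "P ** transpose P = P"
    by (metis P_def matrix_mul_assoc)
  then have "transpose P = P"
    by (metis matrix_transpose_mul transpose_transpose)
  with PA show thesis
    by (intro that[of "G ** transpose A"]) (simp_all add: P_def)
qed

text \<open>\<open>Y\<close> handles symmetry on the left of \<open>A\<close>, and the same
  construction for \<open>transpose A\<close> gives \<open>Z\<close> for the right. Their
  combination \<open>Z ** A ** Y\<close> inherits both.\<close>

lemma is_pseudoinverse_exists:
  fixes A :: "real^'n^'m"
  obtains X where "is_pseudoinverse A X"
proof -
  obtain Y where Y: "A ** Y ** A = A" "transpose (A ** Y) = A ** Y"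
    using least_squares_inverse_exists .
  obtain W where W: "transpose A ** W ** transpose A = transpose A"
      "transpose (transpose A ** W) = transpose A ** W"
    using least_squares_inverse_exists .
  define Z where "Z = transpose W"
  have Z: "A ** Z ** A = A" "transpose (Z ** A) = Z ** A"
    unfolding Z_def
    by (metis W(1) matrix_transpose_mul transpose_transpose matrix_mul_assoc)
       (metis W(2) matrix_transpose_mul transpose_transpose)
  define X where "X = Z ** A ** Y"
  have "A ** X = A ** Y" "X ** A = Z ** A"
    unfolding X_def using Y Z by (metis matrix_mul_assoc)+
  moreover have "Z ** A ** X = X"
    unfolding X_def using Y Z by (metis matrix_mul_assoc)
  ultimately have "is_pseudoinverse A X"
    unfolding is_pseudoinverse_def using Y Z by simp
  then show thesis by (rule that)
qed

text \<open>Transposing a product of two symmetric projections swaps the factors, which forces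
  \<open>A ** X = A ** Y\<close> and \<open>X ** A = Y ** A\<close>. Then X = XAX = YAX = YAY =
  Y.\<close>

lemma is_pseudoinverse_unique:
  assumes X: "is_pseudoinverse A X" and Y: "is_pseudoinverse A Y"
  shows "X = Y"
proof -
  have "A ** X = A ** Y ** (A ** X)"
    using X Y unfolding is_pseudoinverse_def by (metis matrix_mul_assoc)
  also have "\<dots> = transpose (A ** X ** (A ** Y))"
    using X Y unfolding is_pseudoinverse_def by (metis matrix_transpose_mul)
  also have "\<dots> = A ** Y"
    using X Y unfolding is_pseudoinverse_def by (metis matrix_mul_assoc)
  finally have AX: "A ** X = A ** Y" .
  have "X ** A = X ** A ** (Y ** A)"
    using X Y unfolding is_pseudoinverse_def by (metis matrix_mul_assoc)
  also have "\<dots> = transpose (Y ** A ** (X ** A))"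
    using X Y unfolding is_pseudoinverse_def by (metis matrix_transpose_mul)
  also have "\<dots> = Y ** A"
    using X Y unfolding is_pseudoinverse_def by (metis matrix_mul_assoc)
  finally have XA: "X ** A = Y ** A" .
  show ?thesis
    using AX XA X Y unfolding is_pseudoinverse_def by (metis matrix_mul_assoc)
qed

lemma is_pseudoinverse_pseudoinverse: "is_pseudoinverse A (pseudoinverse A)"
  unfolding pseudoinverse_def
  by (rule theI') (meson is_pseudoinverse_exists is_pseudoinverse_unique)

lemma pseudoinverse_in_row_space:
  "pseudoinverse A *v y \<in> range ((*v) (transpose A))"
proof -
  let ?X = "pseudoinverse A"
  have "?X = transpose (?X ** A) ** ?X"
    using is_pseudoinverse_pseudoinverse[of A] unfolding is_pseudoinverse_def by simp
  then have "?X *v y = transpose A *v (transpose ?X *v (?X *v y))"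
    by (metis matrix_transpose_mul matrix_vector_mul_assoc)
  then show ?thesis by blast
qed

text \<open>These two properties are all that the convergence argument uses of the pseudoinverse.
  The second holds because \<open>x0 - xstar\<close> is the pseudoinverse applied to the initial
  residual.\<close>

lemma pseudoinverse_solution:
  fixes A :: "real^'n^'m"
  assumes "A *v z = b"
    and "xstar = pseudoinverse A *v b + (mat 1 - pseudoinverse A ** A) *v x0"
  shows "A *v xstar = b" "x0 - xstar \<in> range ((*v) (transpose A))"
proof -
  have AXA: "A *v (pseudoinverse A *v (A *v v)) = A *v v" for v
    using is_pseudoinverse_pseudoinverse[of A] unfolding is_pseudoinverse_def
    by (metis matrix_vector_mul_assoc)
  have xs: "xstar = pseudoinverse A *v b + (x0 - pseudoinverse A *v (A *v x0))"
    by (simp add: assms(2) matrix_vector_mult_diff_rdistrib matrix_vector_mul_assoc)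
  show "A *v xstar = b"
    unfolding xs assms(1)[symmetric]
    by (simp add: matrix_vector_right_distrib matrix_vector_mult_diff_distrib AXA)
  have "x0 - xstar = pseudoinverse A *v (A *v x0 - b)"
    by (simp add: xs matrix_vector_mult_diff_distrib)
  then show "x0 - xstar \<in> range ((*v) (transpose A))"
    by (simp only: pseudoinverse_in_row_space)
qed

section \<open>The smallest nonzero singular value\<close>

lemma norm_diff_scaleR_squared:
  fixes x u :: "'a::real_inner"
  shows "(norm (x - t *\<^sub>R u))\<^sup>2 = (norm x)\<^sup>2 - 2 * t * (u \<bullet> x) + t\<^sup>2 * (norm u)\<^sup>2"
  unfolding power2_norm_eq_inner
  by (simp add: inner_diff_left inner_diff_right inner_commute power2_eq_square algebra_simps)

lemma subspace_row_space: "subspace (range ((*v) (transpose (A :: real^'n^'m))))"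
  by (intro linear_subspace_image subspace_UNIV matrix_vector_mul_linear)

lemma row_in_row_space: "row i A \<in> range ((*v) (transpose (A :: real^'n^'m)))"
  by (metis matrix_vector_mult_basis column_transpose rangeI)

text \<open>The row space is orthogonal to the kernel, so \<open>e\<close> is orthogonal to
  itself.\<close>

lemma row_space_kernel_eq_0:
  fixes A :: "real^'n^'m"
  assumes "e \<in> range ((*v) (transpose A))" "A *v e = 0"
  shows "e = 0"
proof -
  obtain w where "e = transpose A *v w" using assms(1) by blast
  then have "e \<bullet> e = w \<bullet> (A *v e)" by (metis inner_transpose_mult)
  then show ?thesis by (simp add: assms(2))
qed

text \<open>
  A minimizer \<open>v\<close> of the Rayleigh quotient is an eigenvector: otherwise moving from \<open>v\<close> along
  \<open>u = A\<^sup>T A v - l v\<close> would decrease the quotient.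
\<close>

lemma least_eigenvector_on_row_space:
  fixes A :: "real^'n^'m"
  assumes "A \<noteq> 0"
  obtains v l where "v \<noteq> 0" "l > 0" "transpose A *v (A *v v) = l *\<^sub>R v"
    "\<And>e. e \<in> range ((*v) (transpose A)) \<Longrightarrow> l * (norm e)\<^sup>2 \<le> (norm (A *v e))\<^sup>2"
proof -
  let ?R = "range ((*v) (transpose A))"
  note sub = subspace_row_space[of A]
  have "compact (sphere 0 1 \<inter> ?R)"
    by (intro compact_Int_closed compact_sphere closed_subspace sub)
  moreover have "sphere 0 1 \<inter> ?R \<noteq> {}"
  proof -
    obtain i where "row i A \<noteq> 0"
      using assms by (metis row_def vec_lambda_eta vec_eq_iff zero_index)
    then have "(1 / norm (row i A)) *\<^sub>R row i A \<in> sphere 0 1 \<inter> ?R"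
      using subspace_scale[OF sub row_in_row_space] by simp
    then show ?thesis by blast
  qed
  moreover have "continuous_on (sphere 0 1 \<inter> ?R) (\<lambda>v. norm (A *v v))"
    by (intro continuous_intros matrix_vector_mult_linear_continuous_on)
  ultimately obtain v where v: "v \<in> sphere 0 1 \<inter> ?R"
    and vmin: "\<And>u. u \<in> sphere 0 1 \<inter> ?R \<Longrightarrow> norm (A *v v) \<le> norm (A *v u)"
    by (meson continuous_attains_inf)
  define l where "l = (norm (A *v v))\<^sup>2"
  have v0: "v \<noteq> 0" and vR: "v \<in> ?R" and vn: "norm v = 1" using v by auto
  have "l > 0" using row_space_kernel_eq_0[OF vR] v0 by (auto simp: l_def)
  have ray: "l * (norm e)\<^sup>2 \<le> (norm (A *v e))\<^sup>2" if e: "e \<in> ?R" for e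
  proof (cases "e = 0")
    case False
    have "(1 / norm e) *\<^sub>R e \<in> sphere 0 1 \<inter> ?R"
      using subspace_scale[OF sub e] False by simp
    from vmin[OF this] have "norm (A *v v) * norm e \<le> norm (A *v e)"
      using False by (simp add: matrix_vector_mult_scaleR field_simps)
    then have "(norm (A *v v) * norm e)\<^sup>2 \<le> (norm (A *v e))\<^sup>2"
      by (intro power_mono) auto
    then show ?thesis by (simp add: l_def power_mult_distrib)
  qed simp
  define u where "u = transpose A *v (A *v v) - l *\<^sub>R v"
  define q where "q = (norm (A *v u))\<^sup>2 - l * (norm u)\<^sup>2"
  have uR: "u \<in> ?R"
    unfolding u_def by (intro subspace_diff[OF sub] subspace_scale[OF sub] vR) auto
  have q0: "q \<ge> 0" unfolding q_def using ray[OF uR] by simp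
  \<comment> \<open>The Rayleigh bound at \<open>v - t *\<^sub>R u\<close>: the constant terms
    cancel because \<open>norm v = 1\<close>, and by the definition of \<open>u\<close> the linear
    term is \<open>2 * t * (norm u)\<^sup>2\<close>.\<close>
  have key: "2 * t * (norm u)\<^sup>2 \<le> t\<^sup>2 * q" for t
  proof -
    have "v - t *\<^sub>R u \<in> ?R"
      by (intro subspace_diff[OF sub] subspace_scale[OF sub] vR uR)
    from ray[OF this]
    have "l * ((norm v)\<^sup>2 - 2 * t * (v \<bullet> u) + t\<^sup>2 * (norm u)\<^sup>2)
        \<le> (norm (A *v v))\<^sup>2 - 2 * t * ((A *v v) \<bullet> (A *v u)) + t\<^sup>2 * (norm (A *v u))\<^sup>2"
      by (simp only: matrix_vector_mult_diff_distrib matrix_vector_mult_scaleR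
          norm_diff_scaleR_squared inner_commute)
    moreover have "2 * t * (norm u)\<^sup>2 = 2 * t * ((A *v v) \<bullet> (A *v u)) - l * (2 * t * (v \<bullet> u))"
    proof -
      have "(norm u)\<^sup>2 = (transpose A *v (A *v v) - l *\<^sub>R v) \<bullet> u"
        by (simp add: power2_norm_eq_inner u_def)
      then have "(norm u)\<^sup>2 = (A *v v) \<bullet> (A *v u) - l * (v \<bullet> u)"
        by (simp only: inner_diff_left inner_transpose_mult inner_scaleR_left)
      then show ?thesis by (simp add: right_diff_distrib)
    qed
    ultimately show ?thesis
      by (simp add: q_def vn l_def[symmetric] algebra_simps)
  qed
  have "u = 0"
  proof (rule ccontr)
    assume "u \<noteq> 0"
    define n where "n = (norm u)\<^sup>2"
    have n: "n > 0" using \<open>u \<noteq> 0\<close> by (simp add: n_def)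
    \<comment> \<open>Small enough that \<open>t * q\<close> is at most \<open>n\<close>, against
      the lower bound \<open>2 * n\<close> from \<open>key\<close>; the \<open>+ 1\<close> covers
      \<open>q = 0\<close>.\<close>
    define t where "t = n / (q + 1)"
    have t: "t > 0" using n q0 by (simp add: t_def)
    have "t * (2 * n) \<le> t * (t * q)"
      using key[of t] by (simp add: n_def power2_eq_square mult_ac)
    then have "2 * n \<le> t * q" using t by simp
    moreover have "t * q \<le> n"
      using n q0 by (simp add: t_def field_simps)
    ultimately show False using n by simp
  qed
  then have "transpose A *v (A *v v) = l *\<^sub>R v" by (simp add: u_def)
  from v0 \<open>l > 0\<close> this ray show thesis by (rule that)
qed

lemma sigma_min_bound:
  fixes A :: "real^'n^'m"
  assumes "A \<noteq> 0" and e: "e \<in> range ((*v) (transpose A))"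
  shows "(sigma_min A)\<^sup>2 * (norm e)\<^sup>2 \<le> (norm (A *v e))\<^sup>2"
proof -
  obtain v l where v: "v \<noteq> 0" "l > 0" "transpose A *v (A *v v) = l *\<^sub>R v"
    and ray: "\<And>e. e \<in> range ((*v) (transpose A)) \<Longrightarrow> l * (norm e)\<^sup>2 \<le> (norm (A *v e))\<^sup>2"
    using least_eigenvector_on_row_space[OF assms(1)] by blast
  have "sigma_min A = sqrt l"
    unfolding sigma_min_def
  proof (rule Least_equality)
    show "sqrt l \<in> singular_values A \<and> sqrt l \<noteq> 0"
      using v by (auto simp: singular_values_def matrix_vector_mul_assoc[symmetric])
  next
    \<comment> \<open>Only \<open>l' \<noteq> 0\<close> is known at first, as HOL's
      \<open>sqrt\<close> is also nonzero at negative arguments. Dividing the eigenvalue equation by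
      \<open>l'\<close> puts \<open>w\<close> in the row space, and the Rayleigh bound then yields
      \<open>l \<le> l'\<close>.\<close>
    fix s assume "s \<in> singular_values A \<and> s \<noteq> 0"
    then obtain l' w where s: "s = sqrt l'" "l' \<noteq> 0" and "w \<noteq> 0"
      and w: "transpose A *v (A *v w) = l' *\<^sub>R w"
      by (auto simp: singular_values_def matrix_vector_mul_assoc[symmetric])
    have "w = transpose A *v ((1 / l') *\<^sub>R (A *v w))"
      by (simp only: matrix_vector_mult_scaleR w) (simp add: s(2))
    then have "w \<in> range ((*v) (transpose A))" by blast
    from ray[OF this] have "l * (norm w)\<^sup>2 \<le> (norm (A *v w))\<^sup>2" .
    also have "\<dots> = (transpose A *v (A *v w)) \<bullet> w"
      by (simp only: inner_transpose_mult power2_norm_eq_inner)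
    also have "\<dots> = l' * (norm w)\<^sup>2"
      by (simp only: w power2_norm_eq_inner inner_scaleR_left)
    finally show "sqrt l \<le> s" using \<open>w \<noteq> 0\<close> s by simp
  qed
  then show ?thesis using ray[OF e] v(2) by simp
qed

section \<open>One step of the method\<close>

lemma row_inner_eq_mult_component:
  fixes A :: "real^'n^'m"
  shows "row i A \<bullet> x = (A *v x) $ i"
  by (simp add: matrix_vector_mul_component row_def)

text \<open>Pythagoras: \<open>xstar\<close> satisfies equation \<open>i\<close>, so the residual is
  the inner product of the error with the row, and the step removes the component of the error along
  that row.\<close>

lemma kaczmarz_step_error:
  assumes "A *v xstar = b" "row i A \<noteq> 0"
  shows "(norm (kaczmarz_step A b i x - xstar))\<^sup>2
    = (norm (x - xstar))\<^sup>2 - \<bar>row i A \<bullet> x - b $ i\<bar>\<^sup>2 / (norm (row i A))\<^sup>2"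
proof -
  define c where "c = (row i A \<bullet> x - b $ i) / (norm (row i A))\<^sup>2"
  have r: "row i A \<bullet> (x - xstar) = row i A \<bullet> x - b $ i"
    by (simp add: inner_diff_right row_inner_eq_mult_component[of _ _ xstar] assms(1))
  have "kaczmarz_step A b i x - xstar = (x - xstar) - c *\<^sub>R row i A"
    by (simp add: kaczmarz_step_def c_def)
  then have "(norm (kaczmarz_step A b i x - xstar))\<^sup>2
      = (norm (x - xstar))\<^sup>2 - 2 * c * (row i A \<bullet> (x - xstar)) + c\<^sup>2 * (norm (row i A))\<^sup>2"
    by (simp only: norm_diff_scaleR_squared)
  also have "\<dots> = (norm (x - xstar))\<^sup>2 - \<bar>row i A \<bullet> x - b $ i\<bar>\<^sup>2 / (norm (row i A))\<^sup>2"
    unfolding r using assms(2) by (simp add: c_def power2_eq_square divide_simps)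
  finally show ?thesis .
qed

lemma iGRK_Gamma_pos:
  assumes "\<forall>i. row i A \<noteq> 0" "A *v x \<noteq> b"
  shows "iGRK_Gamma A b x > 0"
proof -
  have "iGRK_N A b x \<noteq> {}"
    using assms(2) by (auto simp: iGRK_N_def row_inner_eq_mult_component vec_eq_iff)
  then show ?thesis
    unfolding iGRK_Gamma_def using assms(1) by (intro sum_pos) auto
qed

lemma iGRK_J_residual_ge:
  fixes A :: "real^'n^'m"
  assumes rows: "\<forall>i. row i A \<noteq> 0" and ne: "A *v x \<noteq> b" and i: "i \<in> iGRK_J A b x"
  shows "(norm (A *v x - b))\<^sup>2 / iGRK_Gamma A b x
    \<le> \<bar>row i A \<bullet> x - b $ i\<bar>\<^sup>2 / (norm (row i A))\<^sup>2"
proof -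
  define f where "f j = \<bar>row j A \<bullet> x - b $ j\<bar>\<^sup>2 / (norm (row j A))\<^sup>2" for j
  have "(norm (A *v x - b))\<^sup>2 = (\<Sum>j\<in>UNIV. (row j A \<bullet> x - b $ j)\<^sup>2)"
    unfolding power2_norm_eq_inner
    by (simp add: inner_vec_def[of "A *v x - b"] row_inner_eq_mult_component
        power2_eq_square del: matrix_vector_mul_component)
  \<comment> \<open>Vanishing residuals drop out, which leaves the index set over which
    \<open>iGRK_Gamma\<close> sums.\<close>
  also have "\<dots> = (\<Sum>j\<in>iGRK_N A b x. (row j A \<bullet> x - b $ j)\<^sup>2)"
    by (rule sum.mono_neutral_right) (auto simp: iGRK_N_def)
  also have "\<dots> \<le> (\<Sum>j\<in>iGRK_N A b x. Max (range f) * (norm (row j A))\<^sup>2)"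
  proof (rule sum_mono)
    fix j
    have "(row j A \<bullet> x - b $ j)\<^sup>2 = f j * (norm (row j A))\<^sup>2"
      using rows by (simp add: f_def)
    also have "\<dots> \<le> Max (range f) * (norm (row j A))\<^sup>2"
      by (intro mult_right_mono) auto
    finally show "(row j A \<bullet> x - b $ j)\<^sup>2 \<le> Max (range f) * (norm (row j A))\<^sup>2" .
  qed
  also have "\<dots> = Max (range f) * iGRK_Gamma A b x"
    by (simp add: iGRK_Gamma_def sum_distrib_left)
  finally have "(norm (A *v x - b))\<^sup>2 / iGRK_Gamma A b x \<le> Max (range f)"
    using iGRK_Gamma_pos[OF rows ne] by (simp add: pos_divide_le_eq)
  moreover have "1 / 2 * (Max (range f) + (norm (A *v x - b))\<^sup>2 / iGRK_Gamma A b x) \<le> f i"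
    using i unfolding iGRK_J_def f_def by simp
  moreover have "g \<le> M \<Longrightarrow> 1 / 2 * (M + g) \<le> r \<Longrightarrow> g \<le> r" for g M r :: real
    by simp
  ultimately show ?thesis unfolding f_def[of i, symmetric] by blast
qed

theorem theorem2p2:
  fixes A :: "real^'n^'m" and b :: "real^'m"
    and x0 xstar :: "real^'n" and x :: "nat \<Rightarrow> real^'n"
  assumes rows_nonzero: "\<forall>i. row i A \<noteq> 0"
    and consistent: "\<exists>z. A *v z = b"
    and xstar: "xstar = pseudoinverse A *v b + (mat 1 - pseudoinverse A ** A) *v x0"
    and iGRK: "iGRK_sequence A b x0 x"
  shows "\<forall>k. (norm (x (Suc k) - xstar))\<^sup>2 \<le>
           (if A *v x k = b then 0
            else (1 - (sigma_min A)\<^sup>2 / iGRK_Gamma A b (x k)) * (norm (x k - xstar))\<^sup>2)"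
proof
  fix k
  obtain z where "A *v z = b" using consistent by blast
  note sol = pseudoinverse_solution[OF this xstar]
  obtain i where x0: "x 0 = x0" and J: "\<And>k. i k \<in> iGRK_J A b (x k)"
    and step: "\<And>k. x (Suc k) = kaczmarz_step A b (i k) (x k)"
    using iGRK unfolding iGRK_sequence_def by blast
  \<comment> \<open>Each step subtracts a multiple of a row, so membership in the row space
    persists.\<close>
  have err: "x k - xstar \<in> range ((*v) (transpose A))" for k
  proof (induction k)
    case 0
    then show ?case using sol(2) x0 by simp
  next
    case (Suc k)
    have "x (Suc k) - xstar = (x k - xstar) -
        ((row (i k) A \<bullet> x k - b $ i k) / (norm (row (i k) A))\<^sup>2) *\<^sub>R row (i k) A"
      by (simp add: step kaczmarz_step_def)
    also have "\<dots> \<in> range ((*v) (transpose A))"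
      by (intro subspace_diff subspace_scale subspace_row_space Suc row_in_row_space)
    finally show ?case .
  qed
  have A_err: "A *v (x k - xstar) = A *v x k - b"
    by (simp add: matrix_vector_mult_diff_distrib sol(1))
  have dec: "(norm (x (Suc k) - xstar))\<^sup>2 = (norm (x k - xstar))\<^sup>2
      - \<bar>row (i k) A \<bullet> x k - b $ i k\<bar>\<^sup>2 / (norm (row (i k) A))\<^sup>2"
    unfolding step using kaczmarz_step_error[OF sol(1)] rows_nonzero by blast
  show "(norm (x (Suc k) - xstar))\<^sup>2 \<le>
           (if A *v x k = b then 0
            else (1 - (sigma_min A)\<^sup>2 / iGRK_Gamma A b (x k)) * (norm (x k - xstar))\<^sup>2)"
  proof (cases "A *v x k = b")
    \<comment> \<open>The error lies in both the row space and the kernel, so it is already 0, and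
      by \<open>dec\<close> it cannot grow.\<close>
    case True
    then have "x k - xstar = 0"
      using row_space_kernel_eq_0[OF err] A_err by simp
    then show ?thesis using dec True by simp
  next
    case False
    have "row (i k) A \<noteq> 0" using rows_nonzero by blast
    then have "A \<noteq> 0" by (auto simp: row_def vec_eq_iff)
    from sigma_min_bound[OF this err[of k]]
    have "(sigma_min A)\<^sup>2 * (norm (x k - xstar))\<^sup>2 / iGRK_Gamma A b (x k)
        \<le> (norm (A *v x k - b))\<^sup>2 / iGRK_Gamma A b (x k)"
      using iGRK_Gamma_pos[OF rows_nonzero False] by (simp add: A_err divide_right_mono)
    also note iGRK_J_residual_ge[OF rows_nonzero False J]
    finally show ?thesis using dec False by (simp add: algebra_simps)
  qed
qed

end
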